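(* Up to isomorphism, the Paley graph $QR_{13}$ is the only $3$-non-compliant graph on $13$ vertices.
   Context: All graphs are finite, simple and undirected; $\overline{G}$ denotes the complement of $G$. A minor of $G$ is a graph obtained from $G$ by a sequence of vertex deletions, edge deletions and edge contractions (contraction identifies the endpoints of an edge and removes loops and multiple edges). $\Delta(H)$ is the maximum degree of $H$. For an integer $k\ge 1$, a graph $G$ on $n$ vertices is $k$-compliant if $G$ or $\overline{G}$ has a minor $H$ with $\Delta(H)\ge n-k$; otherwise $G$ is $k$-non-compliant. The Paley graph $QR_{13}$ has vertex set $\mathbb{Z}/13\mathbb{Z}$, with $x\ne y$ adjacent iff $x-y$ is a nonzero quadratic residue modulo $13$. *)

theory Defs
  imports
    "HOL-Number_Theory.Number_Theory"
    "Graph_Theory.Pair_Digraph"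
    "Graph_Theory.Digraph_Isomorphism"
begin

text \<open>
  A finite simple undirected graph is a \<^locale>\<open>pair_graph\<close>: a finite, loop-free, symmetric digraph
  without parallel arcs. An undirected edge between \<open>u\<close> and \<open>v\<close> is the pair of arcs \<open>(u, v)\<close>, \<open>(v, u)\<close>.
\<close>

definition complement_graph :: "'a pair_pre_digraph \<Rightarrow> 'a pair_pre_digraph" where
  "complement_graph G =
     \<lparr>pverts = pverts G,
      parcs = {(x, y). x \<in> pverts G \<and> y \<in> pverts G \<and> x \<noteq> y \<and> (x, y) \<notin> parcs G}\<rparr>"

definition delete_vertex :: "'a \<Rightarrow> 'a pair_pre_digraph \<Rightarrow> 'a pair_pre_digraph" where
  "delete_vertex v G =
     \<lparr>pverts = pverts G - {v}, parcs = {(x, y) \<in> parcs G. x \<noteq> v \<and> y \<noteq> v}\<rparr>"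

definition delete_edge :: "'a \<Rightarrow> 'a \<Rightarrow> 'a pair_pre_digraph \<Rightarrow> 'a pair_pre_digraph" where
  "delete_edge u v G = \<lparr>pverts = pverts G, parcs = parcs G - {(u, v), (v, u)}\<rparr>"

text \<open>
  The vertex obtained by identifying \<open>u\<close> and \<open>v\<close> is again called \<open>u\<close>, so that minors of a graph
  have the same vertex type. Since arcs form a set of pairs, parallel edges merge.
\<close>

definition contract_edge :: "'a \<Rightarrow> 'a \<Rightarrow> 'a pair_pre_digraph \<Rightarrow> 'a pair_pre_digraph" where
  "contract_edge u v G =
     (let f = id(v := u) in
      \<lparr>pverts = f ` pverts G,
       parcs = {(f x, f y) | x y. (x, y) \<in> parcs G \<and> f x \<noteq> f y}\<rparr>)"

inductive minor_step :: "'a pair_pre_digraph \<Rightarrow> 'a pair_pre_digraph \<Rightarrow> bool" where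
  delete_vertex: "v \<in> pverts G \<Longrightarrow> minor_step G (delete_vertex v G)"
| delete_edge: "(u, v) \<in> parcs G \<Longrightarrow> minor_step G (delete_edge u v G)"
| contract_edge: "(u, v) \<in> parcs G \<Longrightarrow> minor_step G (contract_edge u v G)"

definition is_minor :: "'a pair_pre_digraph \<Rightarrow> 'a pair_pre_digraph \<Rightarrow> bool" where
  "is_minor H G \<longleftrightarrow> minor_step\<^sup>*\<^sup>* G H"

text \<open>
  In a symmetric digraph the degree of a vertex is its out-degree.
  The inserted \<open>0\<close> only fixes the maximum degree of the graph without vertices.
\<close>

definition max_degree :: "'a pair_pre_digraph \<Rightarrow> nat" where
  "max_degree H = Max (insert 0 (out_degree (with_proj H) ` pverts H))"

text \<open>
  For \<open>k > n\<close> the truncated difference \<open>n - k\<close> is \<open>0\<close>, and both readings of the bound hold trivially.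
\<close>

definition compliant :: "nat \<Rightarrow> 'a pair_pre_digraph \<Rightarrow> bool" where
  "compliant k G \<longleftrightarrow>
     (\<exists>H. (is_minor H G \<or> is_minor H (complement_graph G)) \<and>
          max_degree H \<ge> card (pverts G) - k)"

text \<open>
  The residue classes modulo 13 are represented by \<open>0, \<dots>, 12\<close>; for distinct representatives,
  \<open>x - y\<close> is nonzero modulo 13.
\<close>

definition QR13 :: "int pair_pre_digraph" where
  "QR13 =
     \<lparr>pverts = {0..<13},
      parcs = {(x, y). x \<in> {0..<13} \<and> y \<in> {0..<13} \<and> x \<noteq> y \<and> QuadRes 13 (x - y)}\<rparr>"

abbreviation graph_iso :: "'a pair_pre_digraph \<Rightarrow> 'b pair_pre_digraph \<Rightarrow> bool" where
  "graph_iso G H \<equiv> digraph_iso (with_proj G) (with_proj H)"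

end

theory Submission
  imports Defs
begin

text \<open>
  A minor with a vertex of degree \<open>d\<close> is the same as a connected vertex set with \<open>d\<close> outer neighbours.
  For 13 vertices and \<open>d = 10\<close> this set has at most three elements, so that \<open>G\<close> is non-compliant only if
  any two neighbours of a vertex \<open>v\<close> have a common non-neighbour outside \<open>N(v) \<union> {v}\<close> and, dually, any two
  non-neighbours of \<open>v\<close> have a common neighbour in \<open>N(v)\<close>. Hence each non-neighbour of \<open>v\<close> has at least 3
  neighbours in \<open>N(v)\<close> and each neighbour of \<open>v\<close> has at least 3 non-neighbours outside. Counting all
  pairs gives \<open>36 \<le> d (12 - d)\<close> for the degree \<open>d\<close> of \<open>v\<close>, so \<open>d = 6\<close> with equality everywhere:
  \<open>G\<close> is strongly regular with parameters \<open>(13, 6, 2, 3)\<close>. In such a graph every neighbourhood induces a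
  hexagon, and a hexagon around one vertex determines the remaining adjacencies up to relabelling.
\<close>

section \<open>Double counting for an incidence relation\<close>

text \<open>If \<open>x\<close> were related to at most two elements \<open>c\<close> and
  \<open>d\<close>, some \<open>y\<close> in \<open>M\<close> would be missed by both, and then
  nothing in \<open>N\<close> could be related to \<open>x\<close> and \<open>y\<close> at once. The
  elements \<open>c\<close> and \<open>d\<close> may coincide.\<close>

lemma card_ge_3_if_pairs_missed:
  assumes "finite N" "x \<in> M"
    and miss: "\<And>a b. a \<in> N \<Longrightarrow> b \<in> N \<Longrightarrow> \<exists>y\<in>M. \<not> R a y \<and> \<not> R b y"
    and meet: "\<And>y z. y \<in> M \<Longrightarrow> z \<in> M \<Longrightarrow> \<exists>a\<in>N. R a y \<and> R a z"
  shows "3 \<le> card {a \<in> N. R a x}"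
proof (rule ccontr)
  let ?P = "{a \<in> N. R a x}"
  assume "\<not> 3 \<le> card ?P"
  moreover obtain c where c: "c \<in> ?P" using meet[OF \<open>x \<in> M\<close> \<open>x \<in> M\<close>] by blast
  ultimately have "card (?P - {c}) \<le> Suc 0" by simp
  then have eq: "\<forall>a\<in>?P - {c}. \<forall>b\<in>?P - {c}. a = b"
    using \<open>finite N\<close> by (subst (asm) card_le_Suc0_iff_eq) auto
  obtain d where d: "d \<in> ?P" "?P \<subseteq> {c, d}"
  proof (cases "?P \<subseteq> {c}")
    case True
    with c that show ?thesis by blast
  next
    case False
    with eq that show ?thesis by blast
  qed
  obtain y where "y \<in> M" "\<not> R c y" "\<not> R d y" using miss[of c d] c d by blast
  moreover from this obtain a where "a \<in> N" "R a x" "R a y" using meet \<open>x \<in> M\<close> by blast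
  ultimately show False using d by blast
qed

text \<open>Each pair in \<open>N\<close> times \<open>M\<close> is related or not, so the counts
  \<open>?P\<close> and \<open>?T\<close> add up to \<open>card N * card M\<close>. All twelve
  counts are at least 3 while the product is at most 36, so every inequality is an equality.\<close>

lemma intersecting_incidence_balanced:
  assumes fin: "finite N" "finite M" and sum12: "card N + card M = 12"
    and miss: "\<And>a b. a \<in> N \<Longrightarrow> b \<in> N \<Longrightarrow> \<exists>x\<in>M. \<not> R a x \<and> \<not> R b x"
    and meet: "\<And>x y. x \<in> M \<Longrightarrow> y \<in> M \<Longrightarrow> \<exists>a\<in>N. R a x \<and> R a y"
  shows "card N = 6" "x \<in> M \<Longrightarrow> card {a \<in> N. R a x} = 3"
    and "a \<in> N \<Longrightarrow> card {x \<in> M. R a x} = 3"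
proof -
  let ?P = "\<lambda>x. card {a \<in> N. R a x}" and ?T = "\<lambda>a. card {x \<in> M. \<not> R a x}"
  have P3: "3 \<le> ?P x" if "x \<in> M" for x
    using card_ge_3_if_pairs_missed[OF fin(1) that miss meet] .
  have T3: "3 \<le> ?T a" if "a \<in> N" for a
    \<comment> \<open>Duality: exchanging \<open>N\<close> with \<open>M\<close> and negating
      \<open>R\<close> exchanges \<open>miss\<close> and \<open>meet\<close>.\<close>
    using card_ge_3_if_pairs_missed[OF fin(2) that, of "\<lambda>x a. \<not> R a x"] miss meet by simp
  have split: "card {x \<in> M. R a x} + ?T a = card M" for a
    using card_Un_disjoint[of "{x \<in> M. R a x}" "{x \<in> M. \<not> R a x}"] fin
    by (simp add: Un_def conj_disj_distribL[symmetric] disjoint_iff)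
  have "(\<Sum>x\<in>M. ?P x) = (\<Sum>a\<in>N. card {x \<in> M. R a x})"
    using sum.swap[of "\<lambda>x a. of_bool (R a x) :: nat" N M] fin
    by (simp add: Collect_conj_eq Int_commute)
  then have total: "(\<Sum>x\<in>M. ?P x) + (\<Sum>a\<in>N. ?T a) = card N * card M"
    by (simp add: sum.distrib[symmetric] split)
  \<comment> \<open>Each sum is split into its guaranteed part and its excess over 3; equality will
    force the excess to vanish.\<close>
  have sums: "(\<Sum>x\<in>M. ?P x) = (\<Sum>x\<in>M. ?P x - 3) + 3 * card M"
    "(\<Sum>a\<in>N. ?T a) = (\<Sum>a\<in>N. ?T a - 3) + 3 * card N"
    by (simp_all add: sum_subtractf_nat P3 T3 sum_mono[of M "\<lambda>_. 3" ?P, simplified]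
        sum_mono[of N "\<lambda>_. 3" ?T, simplified])
  have "card M = 12 - card N" "card N \<le> 12" using sum12 by auto
  \<comment> \<open>Two naturals with sum 12 have product at most 36, attained only by 6 and
    6.\<close>
  then have "card N * card M \<le> 36 \<and> (card N * card M = 36 \<longrightarrow> card N = 6)"
    by (simp add: le_Suc_eq numeral_eq_Suc) presburger
  with total sums sum12
  have ex: "(\<Sum>x\<in>M. ?P x - 3) = 0" "(\<Sum>a\<in>N. ?T a - 3) = 0" and N6: "card N = 6" by linarith+
  from N6 show "card N = 6" .
  show "card {a \<in> N. R a x} = 3" if "x \<in> M"
    using ex(1) P3[OF that] fin that by (auto intro: le_antisym)
  show "card {x \<in> M. R a x} = 3" if "a \<in> N"
    using ex(2) T3[OF that] fin that split[of a] N6 sum12 by (auto intro: le_antisym)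
qed

text \<open>Turns a degree or common-neighbour count into a sum of zeros and ones over an explicit
  vertex list, which the simplifier evaluates as far as adjacencies are known.\<close>

lemma card_Collect_eq_sum_list:
  "distinct xs \<Longrightarrow> card {x \<in> set xs. P x} = (\<Sum>x\<leftarrow>xs. of_bool (P x))"
proof (induction xs)
  case (Cons y ys)
  have "{x \<in> set (y # ys). P x} = (if P y then {y} else {}) \<union> {x \<in> set ys. P x}" by auto
  with Cons show ?case by simp
qed simp

lemma exists_insert_if_card_Suc:
  assumes "B \<subseteq> A" "finite B" "card A = Suc (card B)"
  obtains x where "x \<notin> B" "A = insert x B"
proof -
  have "finite A" using assms(3) by (simp add: card_ge_0_finite)
  with assms have "card (A - B) = 1" by (simp add: card_Diff_subset)
  then obtain x where "A - B = {x}" by (auto simp: card_1_singleton_iff)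
  with assms(1) that[of x] show ?thesis by blast
qed

section \<open>Paley labelling of a strongly regular graph\<close>

locale srg_13_6_2_3 =
  fixes V :: "'a set" and E :: "'a \<Rightarrow> 'a \<Rightarrow> bool"
  assumes card_V: "card V = 13"
    and sym: "E x y \<Longrightarrow> E y x"
    and irrefl: "\<not> E x x"
    and in_V: "E x y \<Longrightarrow> x \<in> V"
    and degree: "x \<in> V \<Longrightarrow> card {y \<in> V. E x y} = 6"
    and common_adj: "E x y \<Longrightarrow> card {z \<in> V. E x z \<and> E y z} = 2"
    and common_nonadj:
      "x \<in> V \<Longrightarrow> y \<in> V \<Longrightarrow> x \<noteq> y \<Longrightarrow> \<not> E x y \<Longrightarrow> card {z \<in> V. E x z \<and> E y z} = 3"
begin

lemma finite_V: "finite V"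
  using card_V by (simp add: card_ge_0_finite)

text \<open>The six listed residues are the nonzero squares modulo 13.\<close>

definition paley_labelling :: "(int \<Rightarrow> 'a) \<Rightarrow> bool" where
  "paley_labelling L \<longleftrightarrow> bij_betw L {0..<13} V \<and>
    (\<forall>i\<in>{0..<13}. \<forall>j\<in>{0..<13}. E (L i) (L j) \<longleftrightarrow> (i - j) mod 13 \<in> {1, 3, 4, 9, 10, 12})"

context
  fixes xs
  assumes V: "V = set xs" and dist: "distinct xs"
begin

lemma nbr_eq_filter: "{y. E x y} = set (filter (E x) xs)"
  using V in_V sym by auto

lemma degree_list: "x \<in> V \<Longrightarrow> (\<Sum>z\<leftarrow>xs. of_bool (E x z)) = (6::nat)"
  using degree[of x] card_Collect_eq_sum_list[OF dist] V by metis

lemma common_adj_list: "E x y \<Longrightarrow> (\<Sum>z\<leftarrow>xs. of_bool (E x z \<and> E y z)) = (2::nat)"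
  using common_adj[of x y] card_Collect_eq_sum_list[OF dist, of "\<lambda>z. E x z \<and> E y z"] V by simp

lemma common_nonadj_list:
  "x \<in> V \<Longrightarrow> y \<in> V \<Longrightarrow> x \<noteq> y \<Longrightarrow> \<not> E x y \<Longrightarrow> (\<Sum>z\<leftarrow>xs. of_bool (E x z \<and> E y z)) = (3::nat)"
  using common_nonadj[of x y] card_Collect_eq_sum_list[OF dist, of "\<lambda>z. E x z \<and> E y z"] V by simp

end

text \<open>The index of \<open>x0, \<dots>, x12\<close> is the residue that the vertex receives in the Paley graph.\<close>

lemma labelling_from_rows:
  assumes V: "V = set [x0, x1, x2, x3, x4, x5, x6, x7, x8, x9, x10, x11, x12]"
    and dist: "distinct [x0, x1, x2, x3, x4, x5, x6, x7, x8, x9, x10, x11, x12]"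
    and row0: "{y. E x0 y} = {x1, x3, x4, x9, x10, x12}"
    and row1: "{y. E x1 y} = {x0, x4, x10, x2, x5, x11}"
    and row12: "{y. E x12 y} = {x0, x3, x9, x2, x8, x11}"
    and row4: "{y. E x4 y} = {x0, x1, x3, x5, x7, x8}"
    and row3: "{y. E x3 y} = {x0, x4, x12, x2, x6, x7}"
  shows "\<exists>L. paley_labelling L"
proof -
  have E0: "E x0 y \<longleftrightarrow> y \<in> {x1, x3, x4, x9, x10, x12}" for y using row0 by blast
  have E1: "E x1 y \<longleftrightarrow> y \<in> {x0, x4, x10, x2, x5, x11}" for y using row1 by blast
  have E12: "E x12 y \<longleftrightarrow> y \<in> {x0, x3, x9, x2, x8, x11}" for y using row12 by blast
  have E4: "E x4 y \<longleftrightarrow> y \<in> {x0, x1, x3, x5, x7, x8}" for y using row4 by blast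
  have E3: "E x3 y \<longleftrightarrow> y \<in> {x0, x4, x12, x2, x6, x7}" for y using row3 by blast
  have swap: "E y x = E x y" for x y using sym by blast
  \<comment> \<open>Symmetry at the five known vertices lets their rows be read from both
    ends.\<close>
  have "E y x0 = E x0 y" "E y x1 = E x1 y" "E y x12 = E x12 y" "E y x4 = E x4 y" "E y x3 = E x3 y"
    for y by (rule swap)+
  note rows = E0 E1 E12 E4 E3 this[unfolded E0 E1 E12 E4 E3]
  have "distinct [x12, x11, x10, x9, x8, x7, x6, x5, x4, x3, x2, x1, x0]" using dist by auto
  note ne = dist[simplified] this[simplified]
  have mem: "x0 \<in> V" "x1 \<in> V" "x2 \<in> V" "x3 \<in> V" "x4 \<in> V" "x5 \<in> V" "x6 \<in> V" "x7 \<in> V"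
    "x8 \<in> V" "x9 \<in> V" "x10 \<in> V" "x11 \<in> V" "x12 \<in> V"
    unfolding V by simp_all
  note adj = common_adj_list[OF V dist] and nonadj = common_nonadj_list[OF V dist]
    and deg = degree_list[OF V dist]
  \<comment> \<open>The adjacent vertices \<open>x0\<close> and \<open>x9\<close> have two common
    neighbours: one is \<open>x12\<close>, and the rows exclude \<open>x1\<close>, \<open>x3\<close>
    and \<open>x4\<close>.\<close>
  have E9_10: "E x9 x10"
    using adj[of x0 x9] by (simp add: rows ne irrefl of_bool_def split: if_splits)
  \<comment> \<open>Four common-neighbour counts and the degree are five equations for the six
    unknown adjacencies of \<open>x9\<close>; among the 64 assignments only one satisfies them. The
    row of \<open>x10\<close> is found likewise.\<close>
  have E9: "\<not> E x9 x2 \<and> E x9 x5 \<and> E x9 x6 \<and> \<not> E x9 x7 \<and> E x9 x8 \<and> \<not> E x9 x11"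
    using nonadj[of x1 x9] adj[of x12 x9] nonadj[of x4 x9] nonadj[of x3 x9] deg[of x9] mem E9_10
    by (simp add: rows ne irrefl)
      (cases "E x9 x2"; cases "E x9 x5"; cases "E x9 x6"; cases "E x9 x7"; cases "E x9 x8"; cases "E x9 x11"; simp)
  have E10: "\<not> E x10 x2 \<and> \<not> E x10 x5 \<and> E x10 x6 \<and> E x10 x7 \<and> \<not> E x10 x8 \<and> E x10 x11"
    using adj[of x1 x10] nonadj[of x12 x10] nonadj[of x4 x10] nonadj[of x3 x10] deg[of x10] mem E9_10
    by (simp add: rows ne irrefl swap[of x10 x9])
      (cases "E x10 x2"; cases "E x10 x5"; cases "E x10 x6"; cases "E x10 x7"; cases "E x10 x8"; cases "E x10 x11"; simp)
  note E9' = E9[unfolded swap[of x9]] and E10' = E10[unfolded swap[of x10]] and E9_10' = sym[OF E9_10]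
  note rows = rows E9 E10 E9' E10' E9_10 E9_10'
  \<comment> \<open>For each of the next six adjacent pairs, the rows known so far leave just two
    candidates for the two common neighbours.\<close>
  have E2: "E x2 x5 \<and> E x2 x11"
    using adj[of x1 x2] by (simp add: rows ne irrefl of_bool_def split: if_splits)
  have E11: "E x11 x2 \<and> E x11 x8"
    using adj[of x12 x11] by (simp add: rows ne irrefl of_bool_def split: if_splits)
  have E5: "E x5 x6 \<and> E x5 x8"
    using adj[of x9 x5] by (simp add: rows ne irrefl of_bool_def split: if_splits)
  have E8: "E x8 x5 \<and> E x8 x7"
    using adj[of x4 x8] by (simp add: rows ne irrefl of_bool_def split: if_splits)
  have E6: "E x6 x2 \<and> E x6 x7"
    using adj[of x3 x6] by (simp add: rows ne irrefl of_bool_def split: if_splits)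
  have E7: "E x7 x6 \<and> E x7 x11"
    using adj[of x10 x7] by (simp add: rows ne irrefl of_bool_def split: if_splits)
  note rows = rows E2 E5 E6 E7 E8 E11 E2[unfolded swap[of x2]] E5[unfolded swap[of x5]] E6[unfolded swap[of x6]]
    E7[unfolded swap[of x7]] E8[unfolded swap[of x8]] E11[unfolded swap[of x11]]
  \<comment> \<open>Each of the remaining vertices now has six known neighbours, so its other
    adjacencies are excluded by the degree.\<close>
  have N2: "\<not> E x2 x7 \<and> \<not> E x2 x8"
    using deg[OF mem(3)] by (simp add: rows ne irrefl of_bool_def split: if_splits)
  have N5: "\<not> E x5 x7 \<and> \<not> E x5 x11"
    using deg[OF mem(6)] by (simp add: rows ne irrefl of_bool_def split: if_splits)
  have N6: "\<not> E x6 x8 \<and> \<not> E x6 x11"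
    using deg[OF mem(7)] by (simp add: rows ne irrefl of_bool_def split: if_splits)
  have N7: "\<not> E x7 x2 \<and> \<not> E x7 x5"
    using deg[OF mem(8)] by (simp add: rows ne irrefl of_bool_def split: if_splits)
  have N8: "\<not> E x8 x2 \<and> \<not> E x8 x6"
    using deg[OF mem(9)] by (simp add: rows ne irrefl of_bool_def split: if_splits)
  have N11: "\<not> E x11 x5 \<and> \<not> E x11 x6"
    using deg[OF mem(12)] by (simp add: rows ne irrefl of_bool_def split: if_splits)
  note rows = rows N2 N5 N6 N7 N8 N11
  let ?xs = "[x0, x1, x2, x3, x4, x5, x6, x7, x8, x9, x10, x11, x12]"
  have Z: "{0..<13::int} = int ` {..<13}"
    using image_int_atLeastLessThan[of 0 13] by (simp add: lessThan_atLeast0)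
  show ?thesis
  unfolding paley_labelling_def
  proof (intro exI conjI)
    have "bij_betw (\<lambda>i. ?xs ! i) {..<13} V"
      using bij_betw_nth[OF dist, of "{..<13}" V] V by simp
    then show "bij_betw (\<lambda>i. ?xs ! nat i) {0..<13::int} V"
      unfolding Z by (auto simp: bij_betw_def inj_on_def image_image)
    show "\<forall>i\<in>{0..<13}. \<forall>j\<in>{0..<13}. E (?xs ! nat i) (?xs ! nat j) \<longleftrightarrow>
        (i - j) mod 13 \<in> {1, 3, 4, 9, 10, 12::int}"
      unfolding Z by (simp add: lessThan_nat_numeral lessThan_Suc rows ne irrefl)
  qed
qed

text \<open>Here \<open>a0\<close> to \<open>a5\<close> form the hexagon around \<open>v\<close>;
  \<open>p\<close> and \<open>p'\<close> are the further common neighbours of the antipodes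
  \<open>a0\<close> and \<open>a3\<close>, \<open>b\<close> and \<open>b'\<close> their private
  ones, and \<open>r\<close>, \<open>r'\<close> the remaining vertices. Counting restricts the rows
  of \<open>a1\<close> and \<open>a2\<close> so far that only two configurations survive, mirror
  images of each other; each supplies the five rows for \<open>labelling_from_rows\<close>.\<close>

lemma labelling_from_antipodes:
  assumes V: "V = set [v, a0, a1, a2, a3, a4, a5, p, p', b, b', r, r']"
    and dist: "distinct [v, a0, a1, a2, a3, a4, a5, p, p', b, b', r, r']"
    and row_v: "{y. E v y} = {a0, a1, a2, a3, a4, a5}"
    and row_a0: "{y. E a0 y} = {v, a1, a5, p, p', b}"
    and row_a3: "{y. E a3 y} = {v, a2, a4, p, p', b'}"
    and hex: "E a1 a2" "\<not> E a1 a4" "\<not> E a1 a5" "\<not> E a2 a4" "\<not> E a2 a5"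
  shows "\<exists>L. paley_labelling L"
proof -
  have Ev: "E v y \<longleftrightarrow> y \<in> {a0, a1, a2, a3, a4, a5}" for y using row_v by blast
  have E0: "E a0 y \<longleftrightarrow> y \<in> {v, a1, a5, p, p', b}" for y using row_a0 by blast
  have E3: "E a3 y \<longleftrightarrow> y \<in> {v, a2, a4, p, p', b'}" for y using row_a3 by blast
  have swap: "E y x = E x y" for x y using sym by blast
  have "E y v = E v y" "E y a0 = E a0 y" "E y a3 = E a3 y" for y by (rule swap)+
  note rows = Ev E0 E3 this[unfolded Ev E0 E3] hex sym[OF hex(1)]
  have dist': "distinct [r', r, b', b, p', p, a5, a4, a3, a2, a1, a0, v]" using dist by auto
  note ne = dist[simplified] dist'[simplified]
  have mem: "a0 \<in> V" "a1 \<in> V" "a2 \<in> V" "a3 \<in> V" unfolding V by simp_all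
  note adj = common_adj_list[OF V dist] and nonadj = common_nonadj_list[OF V dist]
    and deg = degree_list[OF V dist]
  note nbr = nbr_eq_filter[OF V dist]
  \<comment> \<open>Counting with \<open>a0\<close> gives \<open>a1\<close> exactly one neighbour
    among \<open>p\<close>, \<open>p'\<close>, \<open>b\<close>, and counting with \<open>a3\<close>
    exactly one among \<open>p\<close>, \<open>p'\<close>, \<open>b'\<close>. So it has both
    \<open>b\<close> and \<open>b'\<close>, or one of \<open>p\<close>, \<open>p'\<close>; the
    degree settles how many of \<open>r\<close>, \<open>r'\<close> are added. The case of
    \<open>a2\<close> is the reflection.\<close>
  have A1: "{y. E a1 y} \<in> {{v, a0, a2, r, b, b'}, {v, a0, a2, r', b, b'},
      {v, a0, a2, p, r, r'}, {v, a0, a2, p', r, r'}}"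
    unfolding nbr using adj[of a0 a1] nonadj[of a3 a1] deg[of a1] mem
    by (simp add: rows ne irrefl del: set_filter)
      (cases "E a1 p"; cases "E a1 p'"; cases "E a1 b"; cases "E a1 b'"; cases "E a1 r"; cases "E a1 r'";
        simp add: insert_commute del: set_filter)
  have A2: "{y. E a2 y} \<in> {{v, a1, a3, r, b, b'}, {v, a1, a3, r', b, b'},
      {v, a1, a3, p, r, r'}, {v, a1, a3, p', r, r'}}"
    unfolding nbr using nonadj[of a0 a2] adj[of a3 a2] deg[of a2] mem
    by (simp add: rows ne irrefl del: set_filter)
      (cases "E a2 p"; cases "E a2 p'"; cases "E a2 b"; cases "E a2 b'"; cases "E a2 r"; cases "E a2 r'";
        simp add: insert_commute del: set_filter)
  have in_V': "E x y \<Longrightarrow> y \<in> V" for x y using in_V sym by blast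
  have C: "card ({y. E a1 y} \<inter> {y. E a2 y}) = 2"
    using common_adj[OF hex(1)] in_V' by (simp add: Int_def) (metis (no_types, lifting) Collect_cong)
  have swapped: "s = r \<and> s' = r' \<or> s = r' \<and> s' = r" "q = p \<and> q' = p' \<or> q = p' \<and> q' = p"
    if "{s, s'} = {r, r'}" "{q, q'} = {p, p'}" for s s' q q'
    using that by (auto simp: doubleton_eq_iff)
  \<comment> \<open>\<open>s\<close> is the one of \<open>r\<close>, \<open>r'\<close> adjacent to
    \<open>a1\<close>, and \<open>q\<close> the one of \<open>p\<close>, \<open>p'\<close> adjacent
    to \<open>a2\<close>.\<close>
  have left: ?thesis if a1: "{y. E a1 y} = {v, a0, a2, s, b, b'}" and a2: "{y. E a2 y} = {v, a1, a3, q, r, r'}"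
    and s: "{s, s'} = {r, r'}" and q: "{q, q'} = {p, p'}" for s s' q q'
  proof (rule labelling_from_rows[of v a0 q a2 a1 b s' s b' a4 a5 q' a3])
    let ?xs = "[v, a0, q, a2, a1, b, s', s, b', a4, a5, q', a3]"
    show "V = set ?xs"
      by (insert swapped[OF s q], elim disjE conjE) (simp_all add: V insert_commute)
    show "distinct ?xs"
      by (insert swapped[OF s q], elim disjE conjE) (simp_all add: ne)
  qed (insert swapped[OF s q], (elim disjE conjE; simp add: row_v row_a0 row_a3 a1 a2 insert_commute)+)
  \<comment> \<open>The mirror image of \<open>left\<close>: the reflection exchanges
    \<open>a0\<close> with \<open>a3\<close>, \<open>a1\<close> with \<open>a2\<close>,
    \<open>a4\<close> with \<open>a5\<close> and \<open>b\<close> with \<open>b'\<close>.\<close>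
  have right: ?thesis if a1: "{y. E a1 y} = {v, a0, a2, q, r, r'}" and a2: "{y. E a2 y} = {v, a1, a3, s, b, b'}"
    and s: "{s, s'} = {r, r'}" and q: "{q, q'} = {p, p'}" for s s' q q'
  proof (rule labelling_from_rows[of v a3 q a1 a2 b' s' s b a5 a4 q' a0])
    let ?xs = "[v, a3, q, a1, a2, b', s', s, b, a5, a4, q', a0]"
    show "V = set ?xs"
      by (insert swapped[OF s q], elim disjE conjE) (simp_all add: V insert_commute)
    show "distinct ?xs"
      by (insert swapped[OF s q], elim disjE conjE) (simp_all add: ne)
  qed (insert swapped[OF s q], (elim disjE conjE; simp add: row_v row_a0 row_a3 a1 a2 insert_commute)+)
  have fin: "finite ({y. E a1 y} \<inter> {y. E a2 y})" using C by (simp add: card_ge_0_finite)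
  have C': "\<not> {v, x, y} \<subseteq> {y. E a1 y} \<inter> {y. E a2 y}" if "v \<noteq> x" "v \<noteq> y" "x \<noteq> y" for x y
    using card_mono[OF fin, of "{v, x, y}"] C that by auto
  \<comment> \<open>As \<open>v\<close> is one of only two common neighbours of \<open>a1\<close>
    and \<open>a2\<close>, their rows cannot share the pair \<open>r\<close>, \<open>r'\<close> or
    the pair \<open>b\<close>, \<open>b'\<close>; hence they are of opposite types.\<close>
  have C': "\<not> {v, r, r'} \<subseteq> {y. E a1 y} \<inter> {y. E a2 y}" "\<not> {v, b, b'} \<subseteq> {y. E a1 y} \<inter> {y. E a2 y}"
    by (rule C'; simp add: ne)+
  consider (left1) s s' where "{s, s'} = {r, r'}" "{y. E a1 y} = {v, a0, a2, s, b, b'}"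
    | (right1) q q' where "{q, q'} = {p, p'}" "{y. E a1 y} = {v, a0, a2, q, r, r'}"
    using A1 unfolding insert_iff empty_iff by (metis insert_commute)
  note a1_cases = this
  consider (left2) q q' where "{q, q'} = {p, p'}" "{y. E a2 y} = {v, a1, a3, q, r, r'}"
    | (right2) s s' where "{s, s'} = {r, r'}" "{y. E a2 y} = {v, a1, a3, s, b, b'}"
    using A2 unfolding insert_iff empty_iff by (metis insert_commute)
  then show ?thesis
  proof cases
    case left2
    then have "{v, r, r'} \<subseteq> {y. E a2 y}" by simp
    show ?thesis
    proof (rule a1_cases)
      fix q q' assume "{y. E a1 y} = {v, a0, a2, q, r, r'}"
      with \<open>{v, r, r'} \<subseteq> {y. E a2 y}\<close> C'(1) show ?thesis by simp
    qed (use left left2 in blast)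
  next
    case right2
    then have "{v, b, b'} \<subseteq> {y. E a2 y}" by simp
    show ?thesis
    proof (rule a1_cases)
      fix s s' assume "{y. E a1 y} = {v, a0, a2, s, b, b'}"
      with \<open>{v, b, b'} \<subseteq> {y. E a2 y}\<close> C'(2) show ?thesis by simp
    qed (use right right2 in blast)
  qed
qed

section \<open>Hexagonal neighbourhoods\<close>

lemma adj_in_V: "E x y \<Longrightarrow> y \<in> V"
  using in_V sym by blast

lemma card_nbr: "x \<in> V \<Longrightarrow> card {y. E x y} = 6"
  using degree[of x] adj_in_V by (metis (no_types, lifting) Collect_cong)

lemma card_common_adj: "E x y \<Longrightarrow> card {z. E x z \<and> E y z} = 2"
  using common_adj[of x y] adj_in_V by (metis (no_types, lifting) Collect_cong)

lemma card_common_nonadj: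
  "x \<in> V \<Longrightarrow> y \<in> V \<Longrightarrow> x \<noteq> y \<Longrightarrow> \<not> E x y \<Longrightarrow> card {z. E x z \<and> E y z} = 3"
  using common_nonadj[of x y] adj_in_V by (metis (no_types, lifting) Collect_cong)

text \<open>In a 4-clique the two common neighbours of any two members are the other two members. So
  the three outer neighbours of each member are disjoint from those of the others, which needs 4 +
  12 vertices.\<close>

lemma clique_card_ne_4:
  assumes clique: "\<And>x y. x \<in> K \<Longrightarrow> y \<in> K \<Longrightarrow> x \<noteq> y \<Longrightarrow> E x y"
  shows "card K \<noteq> 4"
proof
  assume K4: "card K = 4"
  then have fin: "finite K" by (simp add: card_ge_0_finite)
  have KV: "K \<subseteq> V"
  proof
    fix x assume "x \<in> K"
    with K4 fin have "card (K - {x}) = 3" by simp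
    then have "K - {x} \<noteq> {}" by (metis card.empty zero_neq_numeral)
    then obtain y where "y \<in> K" "y \<noteq> x" by blast
    with clique \<open>x \<in> K\<close> in_V show "x \<in> V" by blast
  qed
  have common: "{z. E x z \<and> E y z} = K - {x, y}" if "x \<in> K" "y \<in> K" "x \<noteq> y" for x y
  proof (rule card_subset_eq[symmetric])
    show "finite {z. E x z \<and> E y z}"
      using card_common_adj[OF clique[OF that]] by (simp add: card_ge_0_finite)
    show "card (K - {x, y}) = card {z. E x z \<and> E y z}"
      using card_common_adj[OF clique[OF that]] that fin K4 by (simp add: card_Diff_subset)
  qed (use clique that in auto)
  let ?D = "\<lambda>x. {y. E x y} - K"
  have D: "finite (?D x)" "card (?D x) = 3" if "x \<in> K" for x
  proof -
    have 6: "card {y. E x y} = 6" using card_nbr that KV by blast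
    then show "finite (?D x)" by (simp add: card_ge_0_finite)
    have "?D x = {y. E x y} - (K - {x})" using irrefl by auto
    moreover have "K - {x} \<subseteq> {y. E x y}" using clique that by auto
    ultimately show "card (?D x) = 3" using 6 that K4 fin by (simp add: card_Diff_subset)
  qed
  have "?D x \<inter> ?D y = {}" if "x \<in> K" "y \<in> K" "x \<noteq> y" for x y
    using common[OF that] by blast
  then have "card (\<Union>x\<in>K. ?D x) = (\<Sum>x\<in>K. card (?D x))"
    using fin D by (intro card_UN_disjoint) blast+
  then have "card (\<Union>x\<in>K. ?D x) = 12" using D K4 by simp
  moreover have "card ((\<Union>x\<in>K. ?D x) \<union> K) = card (\<Union>x\<in>K. ?D x) + card K"
    using fin D by (intro card_Un_disjoint) auto
  moreover have "card ((\<Union>x\<in>K. ?D x) \<union> K) \<le> card V"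
    using KV adj_in_V finite_V by (intro card_mono) auto
  ultimately show False using card_V K4 by simp
qed

lemma triangle_free_nbr: "E v x \<Longrightarrow> E v y \<Longrightarrow> E v z \<Longrightarrow> E x y \<Longrightarrow> E x z \<Longrightarrow> \<not> E y z"
proof
  assume "E v x" "E v y" "E v z" "E x y" "E x z" "E y z"
  moreover from this have "card {v, x, y, z} = 4" using irrefl by (auto simp: card_insert_if)
  ultimately show False using clique_card_ne_4[of "{v, x, y, z}"] sym by blast
qed

text \<open>Adjacent vertices have two common neighbours, so the neighbourhood of \<open>v\<close>
  is 2-regular on six vertices: a hexagon or two triangles. A triangle would give a 4-clique with
  \<open>v\<close>. The cycle is traced from \<open>a0\<close> in both directions until it closes at
  \<open>a3\<close>.\<close>

lemma hexagonal_nbr: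
  assumes "v \<in> V"
  obtains a0 a1 a2 a3 a4 a5 where "distinct [a0, a1, a2, a3, a4, a5]"
    "{y. E v y} = {a0, a1, a2, a3, a4, a5}"
    "{y. E v y \<and> E a0 y} = {a1, a5}" "{y. E v y \<and> E a1 y} = {a0, a2}" "{y. E v y \<and> E a2 y} = {a1, a3}"
    "{y. E v y \<and> E a3 y} = {a2, a4}" "{y. E v y \<and> E a4 y} = {a3, a5}" "{y. E v y \<and> E a5 y} = {a0, a4}"
proof -
  let ?N = "{y. E v y}" and ?C = "\<lambda>a. {y. E v y \<and> E a y}"
  have N6: "card ?N = 6" using card_nbr[OF assms] .
  then have finN: "finite ?N" by (simp add: card_ge_0_finite)
  \<comment> \<open>One step along the cycle: a vertex \<open>a\<close> and its predecessor
    \<open>b\<close> determine the successor \<open>c\<close>.\<close>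
  have other: "\<exists>c. c \<noteq> b \<and> ?C a = {b, c}" if "E v a" "b \<in> ?C a" for a b
  proof -
    have "card (?C a) = Suc (card {b})" using card_common_adj[OF that(1)] by simp
    with that(2) show ?thesis by (metis empty_subsetI exists_insert_if_card_Suc finite.emptyI
          finite_insert insert_commute insert_subset singletonI)
  qed
  obtain a0 where a0: "E v a0" using N6 by (metis Collect_empty_eq card.empty zero_neq_numeral)
  obtain a1 a5 where C0: "?C a0 = {a1, a5}" "a1 \<noteq> a5"
    using card_common_adj[OF a0] by (auto simp: card_2_iff)
  then have a1: "E v a1" "E a0 a1" and a5: "E v a5" "E a0 a5" by blast+
  obtain a2 where C1: "?C a1 = {a0, a2}" "a2 \<noteq> a0" using other[of a1 a0] a0 a1 sym by auto
  obtain a4 where C5: "?C a5 = {a0, a4}" "a4 \<noteq> a0" using other[of a5 a0] a0 a5 sym by auto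
  have "\<not> E a1 a5" "\<not> E a5 a1" using triangle_free_nbr[of v a0 a1 a5] a0 a1 a5 sym by blast+
  moreover have a2: "E v a2" "E a1 a2" and a4: "E v a4" "E a5 a4" using C1 C5 by blast+
  ultimately have ne: "distinct [a0, a1, a2, a5]" "distinct [a0, a1, a4, a5]"
    using a0 a1 a5 irrefl C0 C1 C5 by auto
  \<comment> \<open>Otherwise the cycle closes after four vertices, and \<open>r\<close>, one of the
    two left over, can only be adjacent to \<open>s\<close> inside the neighbourhood.\<close>
  have "a2 \<noteq> a4"
  proof
    assume eq: "a2 = a4"
    have "?C a2 = {a1, a5}"
      using card_common_adj[OF a2(1)] a1 a5 a2 a4 eq sym C0(2)
      by (intro card_subset_eq[symmetric]) (auto simp: card_ge_0_finite)
    then have closed: "?C y \<subseteq> {a0, a1, a2, a5}" if "y \<in> {a0, a1, a2, a5}" for y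
      using that C0(1) C1(1) C5(1) eq by fastforce
    have "card (?N - {a0, a1, a2, a5}) = 2"
      using N6 ne a0 a1 a2 a5 by (simp add: card_Diff_subset)
    then obtain r s where rs: "?N - {a0, a1, a2, a5} = {r, s}" by (auto simp: card_2_iff)
    then have r: "E v r" "r \<notin> {a0, a1, a2, a5}" by blast+
    have "?C r \<subseteq> {s}"
    proof
      fix y assume y: "y \<in> ?C r"
      then have "r \<in> ?C y" using sym r(1) by auto
      then have "y \<notin> {a0, a1, a2, a5}" using closed r(2) by blast
      moreover have "y \<in> ?N" "y \<noteq> r" using y irrefl by auto
      ultimately show "y \<in> {s}" using rs by blast
    qed
    then have "card (?C r) \<le> 1" using card_mono[of "{s}" "?C r"] by simp
    with card_common_adj[OF r(1)] show False by simp
  qed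
  then have ne: "distinct [a0, a1, a2, a4, a5]" using ne by auto
  obtain a3 where a3: "a3 \<notin> {a0, a1, a2, a4, a5}" "?N = insert a3 {a0, a1, a2, a4, a5}"
    using exists_insert_if_card_Suc[of "{a0, a1, a2, a4, a5}" ?N] N6 ne a0 a1 a2 a4 a5 by auto
  then have "E v a3" by blast
  \<comment> \<open>The vertices \<open>a0\<close>, \<open>a1\<close> and \<open>a5\<close> already
    have both of their cycle neighbours.\<close>
  have "?C a3 \<subseteq> {a2, a4}"
  proof
    fix y assume y: "y \<in> ?C a3"
    then have "a3 \<in> ?C y" using sym \<open>E v a3\<close> by auto
    then have "y \<noteq> a0" "y \<noteq> a1" "y \<noteq> a5" using a3(1) C0(1) C1(1) C5(1) by auto
    moreover have "y \<in> ?N" "y \<noteq> a3" using y irrefl by auto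
    ultimately show "y \<in> {a2, a4}" using a3(2) by blast
  qed
  then have C3: "?C a3 = {a2, a4}"
    using card_common_adj[OF \<open>E v a3\<close>] ne by (intro card_subset_eq) auto
  then have "E a3 a2" "E a3 a4" by blast+
  then have C2: "?C a2 = {a1, a3}" and C4: "?C a4 = {a3, a5}"
    using other[of a2 a1] other[of a4 a5] a1 a2 a3 a4 a5 sym \<open>E v a3\<close> by blast+
  show ?thesis
    by (rule that[of a0 a1 a2 a3 a4 a5]) (use ne a3 C0 C1 C2 C3 C4 C5 in auto)
qed

text \<open>Names all vertices from a hexagon around some \<open>v\<close>. The antipodes
  \<open>a0\<close> and \<open>a3\<close> are non-adjacent and share \<open>v\<close>,
  \<open>p\<close> and \<open>p'\<close>; one neighbour of each is still unnamed, giving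
  \<open>b\<close> and \<open>b'\<close>. These eleven vertices leave two, \<open>r\<close> and
  \<open>r'\<close>.\<close>

lemma paley_labelling_exists: "\<exists>L. paley_labelling L"
proof -
  have "V \<noteq> {}" using card_V by auto
  then obtain v where v: "v \<in> V" by blast
  obtain a0 a1 a2 a3 a4 a5 where hex: "distinct [a0, a1, a2, a3, a4, a5]"
    and N: "{y. E v y} = {a0, a1, a2, a3, a4, a5}"
    and C: "{y. E v y \<and> E a0 y} = {a1, a5}" "{y. E v y \<and> E a1 y} = {a0, a2}" "{y. E v y \<and> E a2 y} = {a1, a3}"
    "{y. E v y \<and> E a3 y} = {a2, a4}" "{y. E v y \<and> E a4 y} = {a3, a5}" "{y. E v y \<and> E a5 y} = {a0, a4}"
    using hexagonal_nbr[OF v] .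
  have Ea: "E v a0" "E v a1" "E v a2" "E v a3" "E v a4" "E v a5" using N by blast+
  have E0: "E a0 y \<longleftrightarrow> y = a1 \<or> y = a5" and E1: "E a1 y \<longleftrightarrow> y = a0 \<or> y = a2"
    and E2: "E a2 y \<longleftrightarrow> y = a1 \<or> y = a3" and E3: "E a3 y \<longleftrightarrow> y = a2 \<or> y = a4" if "E v y" for y
    using C that by blast+
  have nv: "v \<notin> {a0, a1, a2, a3, a4, a5}" using N irrefl by blast
  have mem: "a0 \<in> V" "a3 \<in> V" using Ea adj_in_V by blast+
  have "card {y. E a0 y \<and> E a3 y} = 3"
    using card_common_nonadj[OF mem] E0[OF Ea(4)] hex by auto
  moreover have "v \<in> {y. E a0 y \<and> E a3 y}" using Ea sym by blast
  ultimately have "card ({y. E a0 y \<and> E a3 y} - {v}) = 2" by (simp add: card_ge_0_finite)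
  then obtain p p' where pp: "{y. E a0 y \<and> E a3 y} - {v} = {p, p'}" "p \<noteq> p'"
    by (auto simp: card_2_iff)
  then have p: "E a0 p" "E a0 p'" "E a3 p" "E a3 p'" "p \<noteq> v" "p' \<noteq> v" by blast+
  \<comment> \<open>Inside the hexagon the antipodes \<open>a0\<close> and \<open>a3\<close> have no
    common neighbour.\<close>
  have pN: "\<not> E v p" "\<not> E v p'"
    using E0 E3 p hex by auto
  then have pa: "x \<noteq> p" "x \<noteq> p'" if "E v x" for x using that by blast+
  have "card {y. E a0 y} = Suc (card {v, a1, a5, p, p'})" "card {y. E a3 y} = Suc (card {v, a2, a4, p, p'})"
    using card_nbr[OF mem(1)] card_nbr[OF mem(2)] hex nv pp(2) p(5,6) Ea[THEN pa(1)] Ea[THEN pa(2)] by auto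
  moreover have "{v, a1, a5, p, p'} \<subseteq> {y. E a0 y}" "{v, a2, a4, p, p'} \<subseteq> {y. E a3 y}"
    using p Ea sym E0 E3 by auto
  ultimately obtain b b' where b: "b \<notin> {v, a1, a5, p, p'}" "{y. E a0 y} = insert b {v, a1, a5, p, p'}"
    and b': "b' \<notin> {v, a2, a4, p, p'}" "{y. E a3 y} = insert b' {v, a2, a4, p, p'}"
    using exists_insert_if_card_Suc[of "{v, a1, a5, p, p'}" "{y. E a0 y}"]
      exists_insert_if_card_Suc[of "{v, a2, a4, p, p'}" "{y. E a3 y}"] by (metis finite.emptyI finite_insert)
  have bN: "\<not> E v b" "\<not> E v b'" using E0[of b] E3[of b'] b b' by auto
  have "b \<noteq> b'" using pp b b' by blast
  let ?S = "{v, a0, a1, a2, a3, a4, a5, p, p', b, b'}"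
  have d: "distinct [v, a0, a1, a2, a3, a4, a5, p, p', b, b']"
    using hex nv pN bN pp(2) p b b' \<open>b \<noteq> b'\<close> Ea by auto
  have S: "?S \<subseteq> V" using v Ea p b b' adj_in_V by blast
  have "card (V - ?S) = card V - card ?S" using S by (intro card_Diff_subset) auto
  also have "card ?S = 11" using d distinct_card[OF d] by simp
  finally obtain r r' where r: "V - ?S = {r, r'}" "r \<noteq> r'" using card_V by (auto simp: card_2_iff)
  then have "r \<notin> ?S" "r' \<notin> ?S" by blast+
  show ?thesis
  proof (rule labelling_from_antipodes[of v a0 a1 a2 a3 a4 a5 p p' b b' r r'])
    show "V = set [v, a0, a1, a2, a3, a4, a5, p, p', b, b', r, r']" using r S by auto
    show "distinct [v, a0, a1, a2, a3, a4, a5, p, p', b, b', r, r']"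
      using d \<open>r \<notin> ?S\<close> \<open>r' \<notin> ?S\<close> r(2) by auto
  qed (use N b b' E1 E2 Ea hex in auto)
qed

end

section \<open>Simple graphs under complement and minor steps\<close>

lemma pair_graph_iff:
  "pair_graph G \<longleftrightarrow> finite (pverts G) \<and> parcs G \<subseteq> pverts G \<times> pverts G \<and> sym (parcs G) \<and> irrefl (parcs G)"
proof
  assume "pair_graph G"
  then interpret pair_graph G .
  show "finite (pverts G) \<and> parcs G \<subseteq> pverts G \<times> pverts G \<and> sym (parcs G) \<and> irrefl (parcs G)"
    using pair_finite_verts pair_sym_arcs pair_no_loops wellformed' by (auto simp: symmetric_def irrefl_def) blast
next
  assume G: "finite (pverts G) \<and> parcs G \<subseteq> pverts G \<times> pverts G \<and> sym (parcs G) \<and> irrefl (parcs G)"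
  then have "finite (parcs G)" using finite_subset by blast
  with G show "pair_graph G"
    by unfold_locales (auto simp: symmetric_def irrefl_def)
qed

lemma pair_graph_complement: "pair_graph G \<Longrightarrow> pair_graph (complement_graph G)"
  unfolding pair_graph_iff complement_graph_def pair_pre_digraph.simps
  by (auto intro!: symI simp: irrefl_def) (blast dest: symD)
lemma pair_graph_delete_vertex: "pair_graph G \<Longrightarrow> pair_graph (delete_vertex v G)"
  unfolding pair_graph_iff delete_vertex_def pair_pre_digraph.simps
  by (auto intro!: symI simp: irrefl_def dest: symD)
lemma pair_graph_delete_edge: "pair_graph G \<Longrightarrow> pair_graph (delete_edge u v G)"
  unfolding pair_graph_iff delete_edge_def pair_pre_digraph.simps
  by (auto intro!: symI simp: irrefl_def dest: symD)

lemma pair_graph_contract_edge: "pair_graph G \<Longrightarrow> pair_graph (contract_edge u v G)"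
proof -
  assume G: "pair_graph G"
  define f where "f = id(v := u)"
  have H: "pverts (contract_edge u v G) = f ` pverts G"
    "parcs (contract_edge u v G) = {(f x, f y) | x y. (x, y) \<in> parcs G \<and> f x \<noteq> f y}"
    by (simp_all add: contract_edge_def f_def Let_def)
  have "{(f x, f y) | x y. (x, y) \<in> parcs G \<and> f x \<noteq> f y} \<subseteq> f ` pverts G \<times> f ` pverts G"
    using G unfolding pair_graph_iff by blast
  moreover have "sym {(f x, f y) | x y. (x, y) \<in> parcs G \<and> f x \<noteq> f y}"
  proof (rule symI)
    fix s t assume "(s, t) \<in> {(f x, f y) | x y. (x, y) \<in> parcs G \<and> f x \<noteq> f y}"
    then obtain x y where "s = f x" "t = f y" "(x, y) \<in> parcs G" "s \<noteq> t" by blast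
    moreover from this have "(y, x) \<in> parcs G" using G by (meson pair_graph_iff symD)
    ultimately show "(t, s) \<in> {(f x, f y) | x y. (x, y) \<in> parcs G \<and> f x \<noteq> f y}"
      unfolding mem_Collect_eq by (intro exI[of _ y] exI[of _ x]) simp
  qed
  ultimately show ?thesis
    using G unfolding pair_graph_iff H by (auto simp: irrefl_def)
qed

lemma pair_graph_minor_step: "minor_step G H \<Longrightarrow> pair_graph G \<Longrightarrow> pair_graph H"
  by (induction rule: minor_step.induct)
    (simp_all add: pair_graph_delete_vertex pair_graph_delete_edge pair_graph_contract_edge)

section \<open>Branch sets and degrees in minors\<close>

definition outer_nbrs :: "'a pair_pre_digraph \<Rightarrow> 'a set \<Rightarrow> 'a set" where
  "outer_nbrs G S = {y. y \<notin> S \<and> (\<exists>x\<in>S. (x, y) \<in> parcs G)}"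

text \<open>Connectedness is expressed by cuts instead of paths, a form that pulls back directly
  along a contraction.\<close>

definition connected_in :: "'a pair_pre_digraph \<Rightarrow> 'a set \<Rightarrow> bool" where
  "connected_in G S \<longleftrightarrow> S \<noteq> {} \<and> S \<subseteq> pverts G \<and>
    (\<forall>A \<subseteq> S. A \<noteq> {} \<longrightarrow> A \<noteq> S \<longrightarrow> (\<exists>x\<in>A. \<exists>y\<in>S - A. (x, y) \<in> parcs G))"

lemma connected_in_mono:
  assumes "connected_in H S" "pverts H \<subseteq> pverts G" "parcs H \<subseteq> parcs G"
  shows "connected_in G S"
proof -
  have "\<exists>x\<in>A. \<exists>y\<in>S - A. (x, y) \<in> parcs G" if "A \<subseteq> S" "A \<noteq> {}" "A \<noteq> S" for A
    using that assms(1,3) unfolding connected_in_def by (meson subsetD)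
  moreover have "S \<subseteq> pverts G" using assms(1,2) unfolding connected_in_def by blast
  ultimately show ?thesis using assms(1) by (simp add: connected_in_def)
qed

lemma finite_outer_nbrs: "pair_graph G \<Longrightarrow> finite (outer_nbrs G S)"
  by (rule finite_subset[of _ "pverts G"]) (auto simp: pair_graph_iff outer_nbrs_def)

text \<open>The branch set is the preimage of \<open>S\<close>. Fibres of the contraction are single
  vertices or the adjacent pair \<open>u\<close>, \<open>v\<close>, so a subset of \<open>T\<close>
  without outgoing arcs in \<open>T\<close> is a union of fibres and would project to such a subset
  of \<open>S\<close>. Every outer neighbour of \<open>S\<close> is the image of one of
  \<open>T\<close>.\<close>

lemma contract_edge_branch_set:
  assumes G: "pair_graph G" and uv: "(u, v) \<in> parcs G"
    and S: "connected_in (contract_edge u v G) S"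
  defines "T \<equiv> {x \<in> pverts G. (id(v := u)) x \<in> S}"
  shows "connected_in G T" "card (outer_nbrs (contract_edge u v G) S) \<le> card (outer_nbrs G T)"
proof -
  define f where "f = id(v := u)"
  let ?H = "contract_edge u v G"
  have H: "pverts ?H = f ` pverts G" "parcs ?H = {(f x, f y) | x y. (x, y) \<in> parcs G \<and> f x \<noteq> f y}"
    by (simp_all add: contract_edge_def f_def Let_def)
  have T: "T = {x \<in> pverts G. f x \<in> S}" by (simp add: T_def f_def)
  have vu: "(v, u) \<in> parcs G" and wf: "\<And>x y. (x, y) \<in> parcs G \<Longrightarrow> x \<in> pverts G \<and> y \<in> pverts G"
    using G uv by (auto simp: pair_graph_iff sym_def)
  have ker: "x = y \<or> (x, y) \<in> parcs G" if "f x = f y" for x y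
    using that uv vu by (auto simp: f_def split: if_splits)
  have "\<exists>x\<in>A. \<exists>y\<in>T - A. (x, y) \<in> parcs G" if A: "A \<subseteq> T" "A \<noteq> {}" "A \<noteq> T" for A
  proof (rule ccontr)
    assume no: "\<not> (\<exists>x\<in>A. \<exists>y\<in>T - A. (x, y) \<in> parcs G)"
    \<comment> \<open>\<open>A\<close> is a union of fibres within \<open>T\<close>, since distinct
      vertices of a fibre are adjacent.\<close>
    then have sat: "y \<in> A" if "y \<in> T" "f y \<in> f ` A" for y
      using that ker by (metis DiffI imageE)
    have "f ` A \<subseteq> S" "f ` A \<noteq> {}" using A by (auto simp: T)
    moreover have "f ` A \<noteq> S"
    proof -
      obtain y where "y \<in> T" "y \<notin> A" using A by blast
      with sat have "f y \<in> S" "f y \<notin> f ` A" by (auto simp: T)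
      then show ?thesis by blast
    qed
    ultimately obtain s t where "s \<in> f ` A" "t \<in> S - f ` A" "(s, t) \<in> parcs ?H"
      using S unfolding connected_in_def by meson
    moreover from this obtain x y where "s = f x" "t = f y" and xy: "(x, y) \<in> parcs G" unfolding H by blast
    ultimately have xy: "(x, y) \<in> parcs G" "f x \<in> f ` A" "f y \<in> S" "f y \<notin> f ` A" by auto
    then have "x \<in> T" "y \<in> T" using wf A by (auto simp: T)
    with sat xy no show False by blast
  qed
  moreover have "T \<noteq> {}" using S by (auto simp: connected_in_def T H)
  ultimately show "connected_in G T" by (auto simp: connected_in_def T)
  have "outer_nbrs ?H S \<subseteq> f ` outer_nbrs G T"
  proof
    fix t assume "t \<in> outer_nbrs ?H S"
    then obtain x y where "t = f y" "f y \<notin> S" "f x \<in> S" "(x, y) \<in> parcs G"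
      by (auto simp: outer_nbrs_def H)
    with wf show "t \<in> f ` outer_nbrs G T" by (auto simp: outer_nbrs_def T)
  qed
  then show "card (outer_nbrs ?H S) \<le> card (outer_nbrs G T)"
    using finite_outer_nbrs[OF G] surj_card_le by blast
qed

lemma minor_step_branch_set:
  assumes "minor_step G H" "pair_graph G" "connected_in H S"
  shows "\<exists>T. connected_in G T \<and> card (outer_nbrs H S) \<le> card (outer_nbrs G T)"
proof -
  have sub: ?thesis if "pverts H \<subseteq> pverts G" "parcs H \<subseteq> parcs G"
  proof (intro exI conjI)
    show "connected_in G S" using connected_in_mono[OF assms(3) that] .
    show "card (outer_nbrs H S) \<le> card (outer_nbrs G S)"
      using that finite_outer_nbrs[OF assms(2)] by (intro card_mono) (auto simp: outer_nbrs_def)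
  qed
  from assms(1) show ?thesis
  proof cases
    case (contract_edge u v)
    then have "connected_in (contract_edge u v G) S" using assms(3) by simp
    from contract_edge_branch_set[OF assms(2) contract_edge(2) this] show ?thesis
      unfolding contract_edge(1) by (intro exI conjI)
  qed (rule sub; auto simp: delete_vertex_def delete_edge_def)+
qed

text \<open>The set is pulled back through the minor steps one at a time, never losing outer
  neighbours.\<close>

lemma minor_branch_set:
  assumes "is_minor H G" "pair_graph G" "connected_in H S"
  shows "\<exists>T. connected_in G T \<and> card (outer_nbrs H S) \<le> card (outer_nbrs G T)"
proof -
  have "minor_step\<^sup>*\<^sup>* G H" using assms(1) by (simp add: is_minor_def)
  then show ?thesis using assms(2,3)
  proof (induction arbitrary: S rule: converse_rtranclp_induct)
    case (step G G')
    then obtain T where "connected_in G' T" "card (outer_nbrs H S) \<le> card (outer_nbrs G' T)"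
      using pair_graph_minor_step by blast
    with minor_step_branch_set[OF step(1) step(4)] show ?case using le_trans by blast
  qed blast
qed

lemma pair_graph_minor: "is_minor H G \<Longrightarrow> pair_graph G \<Longrightarrow> pair_graph H"
  unfolding is_minor_def by (induction rule: rtranclp_induct) (auto intro: pair_graph_minor_step)

lemma out_degree_eq_card_outer_nbrs:
  assumes "pair_graph H"
  shows "out_degree (with_proj H) h = card (outer_nbrs H {h})"
proof -
  have "out_arcs (with_proj H) h = Pair h ` outer_nbrs H {h}"
    using assms by (auto simp: out_arcs_def outer_nbrs_def pair_graph_iff irrefl_def)
  then show ?thesis by (simp add: out_degree_def card_image inj_on_def)
qed

lemma max_degree_minor_branch_set:
  assumes "is_minor H G" "pair_graph G" "d \<le> max_degree H" "0 < d"
  shows "\<exists>T. connected_in G T \<and> d \<le> card (outer_nbrs G T)"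
proof -
  have H: "pair_graph H" using pair_graph_minor assms by blast
  then have "max_degree H \<in> insert 0 (out_degree (with_proj H) ` pverts H)"
    unfolding max_degree_def by (intro Max_in) (auto simp: pair_graph_iff)
  \<comment> \<open>As \<open>d\<close> is positive, the maximum is attained at a vertex and not
    only by the inserted \<open>0\<close>.\<close>
  then obtain h where h: "h \<in> pverts H" "d \<le> card (outer_nbrs H {h})"
    using assms(3,4) out_degree_eq_card_outer_nbrs[OF H] by auto
  have "connected_in H {h}" using h(1) by (auto simp: connected_in_def)
  with minor_branch_set[OF assms(1,2)] h(2) show ?thesis using le_trans by blast
qed

text \<open>Such a set is a vertex, an edge, a path or a triangle, and \<open>v\<close> is a vertex
  adjacent to all others. Smaller sets are covered by letting \<open>a\<close> or \<open>b\<close>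
  equal \<open>v\<close>.\<close>

lemma connected_in_card_le_3:
  assumes T: "connected_in G T" "finite T" "card T \<le> 3" and sym: "sym (parcs G)"
  obtains v a b where "T = {v, a, b}" "a = v \<or> (v, a) \<in> parcs G" "b = v \<or> (v, b) \<in> parcs G"
proof -
  have cut: "\<exists>y\<in>T - A. \<exists>x\<in>A. (x, y) \<in> parcs G" if "A \<subseteq> T" "A \<noteq> {}" "A \<noteq> T" for A
    using T(1) that unfolding connected_in_def by meson
  obtain x where x: "x \<in> T" using T(1) by (auto simp: connected_in_def)
  show ?thesis
  proof (cases "T = {x}")
    case True
    with that[of x x x] show ?thesis by simp
  next
    case False
    then obtain y where y: "y \<in> T" "y \<noteq> x" "(x, y) \<in> parcs G" using cut[of "{x}"] x by auto
    show ?thesis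
    proof (cases "T = {x, y}")
      case True
      with that[of x x y] y show ?thesis by simp
    next
      case False
      then obtain z where z: "z \<in> T" "z \<noteq> x" "z \<noteq> y" "(x, z) \<in> parcs G \<or> (y, z) \<in> parcs G"
        using cut[of "{x, y}"] x y by auto
      have "T = {x, y, z}"
        using T(2,3) x y z by (intro card_seteq[symmetric]) auto
      \<comment> \<open>The centre is whichever of \<open>x\<close> and \<open>y\<close> the third
        vertex is attached to.\<close>
      with that[of x y z] that[of y x z] y z sym show ?thesis
        by (auto simp: sym_def insert_commute)
    qed
  qed
qed

lemma contract_edge_arcI:
  assumes "(x, y) \<in> parcs G" "x' = (id(w := u)) x" "y' = (id(w := u)) y" "x' \<noteq> y'"
  shows "(x', y') \<in> parcs (contract_edge u w G)"
  unfolding contract_edge_def Let_def pair_pre_digraph.simps mem_Collect_eq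
  using assms by (intro exI[of _ x] exI[of _ y]) simp

text \<open>Contracting \<open>a\<close> and \<open>b\<close> into \<open>v\<close> gives a vertex
  adjacent to all vertices outside \<open>{v, a, b}\<close>. If \<open>a = b\<close>, one
  contraction suffices.\<close>

lemma max_degree_contracted_cherry:
  assumes G: "pair_graph G" and va: "(v, a) \<in> parcs G" and vb: "(v, b) \<in> parcs G"
    and dom: "\<And>x. x \<in> pverts G - {v, a, b} \<Longrightarrow> (v, x) \<in> parcs G \<or> (a, x) \<in> parcs G \<or> (b, x) \<in> parcs G"
  shows "\<exists>H. is_minor H G \<and> card (pverts G) - 3 \<le> max_degree H"
proof -
  have ne: "v \<noteq> a" "v \<noteq> b" using G va vb by (auto simp: pair_graph_iff irrefl_def)
  let ?H1 = "contract_edge v a G"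
  have H1: "minor_step G ?H1" using va by (rule minor_step.contract_edge)
  obtain H where H: "is_minor H G" and arcs: "Pair v ` (pverts G - {v, a, b}) \<subseteq> parcs H"
  proof (cases "a = b")
    case True
    have "(v, x) \<in> parcs ?H1" if "x \<in> pverts G - {v, a, b}" for x
      using dom[OF that] True that ne by (auto intro: contract_edge_arcI)
    with H1 that[of ?H1] show ?thesis by (auto simp: is_minor_def)
  next
    case False
    let ?H = "contract_edge v b ?H1"
    have "(v, b) \<in> parcs ?H1" by (rule contract_edge_arcI[OF vb]) (use ne False in auto)
    then have "minor_step ?H1 ?H" by (rule minor_step.contract_edge)
    then have "is_minor ?H G" using H1 by (simp add: is_minor_def)
    moreover have "(v, x) \<in> parcs ?H" if x: "x \<in> pverts G - {v, a, b}" for x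
    proof -
      have "(v, x) \<in> parcs ?H1 \<or> (b, x) \<in> parcs ?H1"
        using dom[OF x] x ne False contract_edge_arcI[of v x G v a v x]
          contract_edge_arcI[of a x G v a v x] contract_edge_arcI[of b x G b a v x] by auto
      then show ?thesis using x ne by (auto intro: contract_edge_arcI)
    qed
    ultimately show ?thesis using that by blast
  qed
  have pH: "pair_graph H" using pair_graph_minor[OF H G] .
  have vs: "v \<in> pverts G" "a \<in> pverts G" "b \<in> pverts G" and finG: "finite (pverts G)"
    using G va vb by (auto simp: pair_graph_iff)
  have "card (pverts G) - 3 \<le> card (pverts G) - card {v, a, b}"
    by (intro diff_le_mono2) (simp add: card_insert_le_m1)
  also have "\<dots> = card (pverts G - {v, a, b})" using vs by (simp add: card_Diff_subset)
  also have "\<dots> \<le> card (outer_nbrs H {v})"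
    by (rule card_mono[OF finite_outer_nbrs[OF pH]]) (use arcs in \<open>auto simp: outer_nbrs_def\<close>)
  also have "\<dots> = out_degree (with_proj H) v" using out_degree_eq_card_outer_nbrs[OF pH] by simp
  finally have deg: "card (pverts G) - 3 \<le> out_degree (with_proj H) v" .
  \<comment> \<open>If no vertex lies outside \<open>{v, a, b}\<close>, the bound is
    \<open>0\<close>; otherwise an arc from \<open>v\<close> shows that \<open>v\<close> is a vertex
    of \<open>H\<close>.\<close>
  show ?thesis
  proof (cases "pverts G - {v, a, b} = {}")
    case True
    then have "card (pverts G) \<le> card {v, a, b}" by (intro card_mono) auto
    also have "\<dots> \<le> 3" by (simp add: card_insert_le_m1)
    finally show ?thesis using H by auto
  next
    case False
    then have "v \<in> pverts H" using arcs pH by (auto simp: pair_graph_iff)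
    then have "out_degree (with_proj H) v \<le> max_degree H"
      unfolding max_degree_def using pH by (intro Max_ge) (auto simp: pair_graph_iff)
    with deg H show ?thesis using le_trans by blast
  qed
qed

section \<open>Isomorphisms and the Paley graph as a circulant\<close>

text \<open>Digraph isomorphisms carry a separate arc map; since arcs are pairs of vertices,
  \<open>map_prod f f\<close> serves.\<close>

lemma graph_isoI:
  assumes "pair_graph G" "pair_graph H" "bij_betw f (pverts G) (pverts H)"
    and arcs: "\<And>x y. x \<in> pverts G \<Longrightarrow> y \<in> pverts G \<Longrightarrow> (x, y) \<in> parcs G \<longleftrightarrow> (f x, f y) \<in> parcs H"
  shows "graph_iso G H"
proof -
  interpret pair_graph G by fact
  let ?h = "\<lparr>iso_verts = f, iso_arcs = map_prod f f, iso_head = snd, iso_tail = fst\<rparr>"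
  have inj: "inj_on f (pverts G)" and img: "f ` pverts G = pverts H"
    using assms(3) by (auto simp: bij_betw_def)
  have sub: "parcs G \<subseteq> pverts G \<times> pverts G" "parcs H \<subseteq> pverts H \<times> pverts H"
    using assms(1,2) by (auto simp: pair_graph_iff)
  have "inj_on (map_prod f f) (parcs G)"
    using map_prod_inj_on[OF inj inj] sub(1) inj_on_subset by blast
  then have "pre_digraph.digraph_isomorphism (with_proj G) ?h"
    using inj wf_digraph by (simp add: pre_digraph.digraph_isomorphism_def)
  moreover have "map_prod f f ` parcs G = parcs H"
  proof (intro equalityI subsetI)
    fix e assume "e \<in> map_prod f f ` parcs G"
    with arcs sub(1) show "e \<in> parcs H" by auto
  next
    fix e assume e: "e \<in> parcs H"
    with sub(2) have "e \<in> f ` pverts G \<times> f ` pverts G" unfolding img by blast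
    then obtain x y where "e = map_prod f f (x, y)" "x \<in> pverts G" "y \<in> pverts G" by auto
    with arcs e show "e \<in> map_prod f f ` parcs G" by auto
  qed
  then have "with_proj H = app_iso ?h (with_proj G)"
    using img by (simp add: app_iso_def with_proj_def)
  ultimately show ?thesis unfolding digraph_iso_def by blast
qed

lemma atLeastLessThan_13: "{0..<13::int} = {0, 1, 2, 3, 4, 5, 6, 7, 8, 9, 10, 11, 12}"
proof -
  have "{0..<13::int} = set [0..12]" by auto
  then show ?thesis by (simp add: upto_rec1)
qed

lemma QuadRes_13_iff: "QuadRes 13 a \<longleftrightarrow> a mod 13 \<in> {0, 1, 3, 4, 9, 10, 12}"
proof
  assume "QuadRes 13 a"
  then obtain y where "y\<^sup>2 mod 13 = a mod 13" by (auto simp: QuadRes_def cong_def)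
  then have "(y mod 13)\<^sup>2 mod 13 = a mod 13" by (simp add: power_mod)
  moreover define z where "z = y mod 13"
  moreover have "z \<in> {0..<13}" by (simp add: z_def)
  then have "z \<in> {0, 1, 2, 3, 4, 5, 6, 7, 8, 9, 10, 11, 12}" by (simp only: atLeastLessThan_13)
  ultimately show "a mod 13 \<in> {0, 1, 3, 4, 9, 10, 12}" by auto
next
  assume "a mod 13 \<in> {0, 1, 3, 4, 9, 10, 12}"
  \<comment> \<open>The candidates are square roots of 0, 1, 3, 4, 9, 10 and 12, in this
    order.\<close>
  then have "\<exists>y\<in>{0, 1, 4, 2, 3, 6, 5::int}. y\<^sup>2 mod 13 = a mod 13" by auto
  then show "QuadRes 13 a" unfolding QuadRes_def cong_def by blast
qed

text \<open>The Cayley graph of the integers modulo 13 with connection set \<open>D\<close>; this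
  form covers both \<open>QR13\<close> and its complement.\<close>

definition circulant_13 :: "int set \<Rightarrow> int pair_pre_digraph" where
  "circulant_13 D = \<lparr>pverts = {0..<13},
     parcs = {(x, y). x \<in> {0..<13} \<and> y \<in> {0..<13} \<and> (x - y) mod 13 \<in> D}\<rparr>"

lemma mod_13_eq_0_iff: "x \<in> {0..<13} \<Longrightarrow> y \<in> {0..<13} \<Longrightarrow> (x - y) mod 13 = 0 \<longleftrightarrow> x = (y::int)"
  by (auto simp: mod_eq_dvd_iff[symmetric] mod_pos_pos_trivial mod_eq_0_iff_dvd)

lemma QR13_eq_circulant: "QR13 = circulant_13 {1, 3, 4, 9, 10, 12}"
proof -
  have "x \<noteq> y \<and> QuadRes 13 (x - y) \<longleftrightarrow> (x - y) mod 13 \<in> {1, 3, 4, 9, 10, 12}"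
    if "x \<in> {0..<13}" "y \<in> {0..<13}" for x y :: int
  proof -
    define m where "m = (x - y) mod 13"
    have xy: "x = y \<longleftrightarrow> m = 0" using mod_13_eq_0_iff[OF that] by (simp only: m_def)
    show ?thesis unfolding QuadRes_13_iff m_def[symmetric] xy by auto
  qed
  then have "x \<in> {0..<13} \<and> y \<in> {0..<13} \<and> x \<noteq> y \<and> QuadRes 13 (x - y) \<longleftrightarrow>
      x \<in> {0..<13} \<and> y \<in> {0..<13} \<and> (x - y) mod 13 \<in> {1, 3, 4, 9, 10, 12}" for x y :: int
    by blast
  then show ?thesis unfolding QR13_def circulant_13_def by (simp only:)
qed

lemma complement_QR13_eq_circulant: "complement_graph QR13 = circulant_13 {2, 5, 6, 7, 8, 11}"
proof -
  have "(x - y) mod 13 \<in> {2, 5, 6, 7, 8, 11} \<longleftrightarrow> x \<noteq> y \<and> (x - y) mod 13 \<notin> {1, 3, 4, 9, 10, 12}"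
    if "x \<in> {0..<13}" "y \<in> {0..<13}" for x y :: int
  proof -
    define m where "m = (x - y) mod 13"
    have "m \<in> {0..<13}" by (simp add: m_def)
    then have m: "m \<in> {0, 1, 2, 3, 4, 5, 6, 7, 8, 9, 10, 11, 12}" by (simp only: atLeastLessThan_13)
    have xy: "x = y \<longleftrightarrow> m = 0" using mod_13_eq_0_iff[OF that] by (simp only: m_def)
    show ?thesis unfolding m_def[symmetric] xy using m by (elim insertE emptyE) simp_all
  qed
  then have "x \<in> {0..<13} \<and> y \<in> {0..<13} \<and> x \<noteq> y \<and>
      \<not> (x \<in> {0..<13} \<and> y \<in> {0..<13} \<and> (x - y) mod 13 \<in> {1, 3, 4, 9, 10, 12}) \<longleftrightarrow>
      x \<in> {0..<13} \<and> y \<in> {0..<13} \<and> (x - y) mod 13 \<in> {2, 5, 6, 7, 8, 11}" for x y :: int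
    by blast
  then show ?thesis unfolding QR13_eq_circulant complement_graph_def circulant_13_def
    by (simp only: pair_pre_digraph.simps mem_Collect_eq case_prod_conv)
qed

lemma pair_graph_circulant_13:
  assumes "\<And>d. d \<in> D \<Longrightarrow> (- d) mod 13 \<in> D" "0 \<notin> D"
  shows "pair_graph (circulant_13 D)"
proof -
  have "(y - x) mod 13 \<in> D" if "(x - y) mod 13 \<in> D" for x y :: int
    using assms(1)[OF that] by (simp add: mod_minus_eq)
  with assms(2) show ?thesis
    by (auto simp: pair_graph_iff circulant_13_def sym_def irrefl_def)
qed

lemma pair_graph_QR13: "pair_graph QR13"
  unfolding QR13_eq_circulant by (rule pair_graph_circulant_13) auto

text \<open>
  The map \<open>w \<mapsto> v - w\<close> turns a path or triangle \<open>{v, a, b}\<close> into \<open>{0, d, e}\<close> with \<open>d, e \<in> D \<union> {0}\<close>.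
  The members of \<open>{0, d, e}\<close> are kept in the list, so that it bounds \<open>13 - |outer neighbours|\<close> from below.
\<close>

definition undominated_13 :: "int list \<Rightarrow> int \<Rightarrow> int \<Rightarrow> int list" where
  "undominated_13 D d e = filter (\<lambda>w. w = 0 \<or> w = d \<or> w = e \<or>
     \<not> (w \<in> set D \<or> (w - d) mod 13 \<in> set D \<or> (w - e) mod 13 \<in> set D)) [0..12]"

text \<open>Ten outer neighbours leave at most three vertices for \<open>T\<close>, so
  \<open>T\<close> has the form \<open>{v, a, b}\<close> with \<open>v\<close> as centre. Reflecting
  an undominated list then gives four vertices that are not outer neighbours of \<open>T\<close>,
  too many among 13.\<close>

lemma circulant_13_branch_set:
  assumes G: "pair_graph (circulant_13 (set D))" and T: "connected_in (circulant_13 (set D)) T"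
    and undominated: "\<And>d e. d \<in> set (0 # D) \<Longrightarrow> e \<in> set (0 # D) \<Longrightarrow> 4 \<le> length (undominated_13 D d e)"
  shows "card (outer_nbrs (circulant_13 (set D)) T) \<le> 9"
proof (rule ccontr)
  let ?G = "circulant_13 (set D)"
  let ?N = "outer_nbrs ?G T"
  assume "\<not> card ?N \<le> 9"
  then have N10: "10 \<le> card ?N" by simp
  have TV: "T \<subseteq> {0..<13}" and NV: "?N \<subseteq> {0..<13} - T"
    using T by (auto simp: connected_in_def circulant_13_def outer_nbrs_def)
  then have finT: "finite T" using finite_subset by blast
  have "card ?N \<le> 13 - card T"
    using card_mono[OF _ NV] card_Diff_subset[OF finT TV] by simp
  then have "card T \<le> 3" using N10 by simp
  then obtain v a b where vab: "T = {v, a, b}" "a = v \<or> (v, a) \<in> parcs ?G" "b = v \<or> (v, b) \<in> parcs ?G"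
    using connected_in_card_le_3[OF T finT] G unfolding pair_graph_iff by blast
  define d e where "d = (v - a) mod 13" and "e = (v - b) mod 13"
  let ?phi = "\<lambda>w. (v - w) mod 13"
  have v: "v \<in> {0..<13}" "a \<in> {0..<13}" "b \<in> {0..<13}" using TV vab(1) by auto
  have "d \<in> set (0 # D)" "e \<in> set (0 # D)"
    using vab by (auto simp: circulant_13_def d_def e_def)
  define U where "U = set (undominated_13 D d e)"
  have U: "w \<in> U \<longleftrightarrow> 0 \<le> w \<and> w \<le> 12 \<and> (w = 0 \<or> w = d \<or> w = e \<or>
      \<not> (w \<in> set D \<or> (w - d) mod 13 \<in> set D \<or> (w - e) mod 13 \<in> set D))" for w
    by (auto simp: U_def undominated_13_def)
  have "card U = length (undominated_13 D d e)"
    unfolding U_def by (rule distinct_card) (simp add: undominated_13_def)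
  then have "4 \<le> card U" using undominated[OF \<open>d \<in> _\<close> \<open>e \<in> _\<close>] by simp
  moreover have "inj_on ?phi U"
  proof (rule inj_onI)
    fix w w' assume "w \<in> U" "w' \<in> U" "?phi w = ?phi w'"
    then have "0 \<le> w" "w \<le> 12" "0 \<le> w'" "w' \<le> 12" "13 dvd (v - w) - (v - w')"
      unfolding U by (simp_all only: mod_eq_dvd_iff)
    then show "w = w'" by presburger
  qed
  ultimately have U4: "4 \<le> card (?phi ` U)" by (simp add: card_image)
  have phi_d: "?phi 0 = v" "?phi d = a" "?phi e = b"
    using v by (simp_all add: d_def e_def mod_diff_right_eq)
  \<comment> \<open>Adjacency of \<open>?phi w\<close> to \<open>v\<close>, \<open>a\<close> and
    \<open>b\<close> becomes membership of \<open>w\<close>, \<open>w - d\<close> and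
    \<open>w - e\<close> in the connection set.\<close>
  have diff: "(v - ?phi w) mod 13 = w mod 13" "(a - ?phi w) mod 13 = (w - d) mod 13"
    "(b - ?phi w) mod 13 = (w - e) mod 13" for w
    by (simp_all add: d_def e_def mod_diff_right_eq algebra_simps)
  have "?phi ` U \<inter> ?N = {}"
  proof safe
    fix w assume w: "w \<in> U" "?phi w \<in> ?N"
    then have "?phi w \<notin> {v, a, b}" by (auto simp: outer_nbrs_def vab)
    then have "w \<noteq> 0" "w \<noteq> d" "w \<noteq> e" using phi_d by auto
    moreover have "\<exists>t\<in>{v, a, b}. (t - ?phi w) mod 13 \<in> set D"
      using w(2) unfolding outer_nbrs_def vab(1) circulant_13_def pair_pre_digraph.simps by blast
    then have "w mod 13 \<in> set D \<or> (w - d) mod 13 \<in> set D \<or> (w - e) mod 13 \<in> set D"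
      unfolding diff[of w, symmetric] by blast
    moreover have "w mod 13 = w" using w(1) by (intro mod_pos_pos_trivial) (simp_all add: U)
    ultimately show "?phi w \<in> {}" using w(1) unfolding U by simp
  qed
  then have "card (?phi ` U \<union> ?N) = card (?phi ` U) + card ?N"
    using finite_outer_nbrs[OF G] by (intro card_Un_disjoint) (simp_all add: U_def)
  moreover have "card (?phi ` U \<union> ?N) \<le> card {0..<13::int}"
    using NV by (intro card_mono) auto
  ultimately show False using U4 N10 by simp
qed

text \<open>A finite evaluation: two connection sets with 49 pairs \<open>d\<close>,
  \<open>e\<close> each.\<close>

lemma QR13_undominated:
  assumes "D = [1, 3, 4, 9, 10, 12] \<or> D = [2, 5, 6, 7, 8, 11]" "d \<in> set (0 # D)" "e \<in> set (0 # D)"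
  shows "4 \<le> length (undominated_13 D d e)"
proof -
  have "\<forall>D\<in>set [[1, 3, 4, 9, 10, 12], [2, 5, 6, 7, 8, 11]]. \<forall>d\<in>set (0 # D). \<forall>e\<in>set (0 # D).
      4 \<le> length (undominated_13 D d e)"
    by code_simp
  then show ?thesis using assms by auto
qed

lemma QR13_not_compliant: "\<not> compliant 3 QR13"
proof
  assume "compliant 3 QR13"
  moreover have card: "card (pverts QR13) = 13" by (simp add: QR13_def)
  ultimately obtain H where H: "is_minor H QR13 \<or> is_minor H (complement_graph QR13)" "10 \<le> max_degree H"
    by (auto simp: compliant_def)
  then obtain G T where "G \<in> {QR13, complement_graph QR13}" "connected_in G T" "10 \<le> card (outer_nbrs G T)"
    using max_degree_minor_branch_set[of H _ 10] pair_graph_QR13 pair_graph_complement by force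
  moreover have "card (outer_nbrs QR13 T) \<le> 9" if "connected_in QR13 T" for T
    using circulant_13_branch_set[of "[1, 3, 4, 9, 10, 12]" T] that pair_graph_QR13 QR13_undominated
    unfolding QR13_eq_circulant by simp
  moreover have "card (outer_nbrs (complement_graph QR13) T) \<le> 9" if "connected_in (complement_graph QR13) T" for T
    using circulant_13_branch_set[of "[2, 5, 6, 7, 8, 11]" T] that pair_graph_complement[OF pair_graph_QR13] QR13_undominated
    unfolding complement_QR13_eq_circulant by simp
  ultimately show False by force
qed

section \<open>From non-compliance to strong regularity\<close>

text \<open>Otherwise \<open>{v, a, b}\<close> dominates the graph, and contracting it yields a
  minor of too large degree.\<close>

lemma not_compliant_common_non_nbr:
  assumes G: "pair_graph G" and nc: "\<And>H. is_minor H G \<Longrightarrow> max_degree H < card (pverts G) - 3"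
    and arcs: "(v, a) \<in> parcs G" "(v, b) \<in> parcs G"
  shows "\<exists>x\<in>pverts G - {v}. (v, x) \<notin> parcs G \<and> (a, x) \<notin> parcs G \<and> (b, x) \<notin> parcs G"
proof (rule ccontr)
  assume "\<not> ?thesis"
  then obtain H where "is_minor H G" "card (pverts G) - 3 \<le> max_degree H"
    using max_degree_contracted_cherry[OF G arcs] by blast
  with nc show False by fastforce
qed

text \<open>The counting lemma is applied at every vertex to its neighbours and its non-neighbours,
  related by adjacency. Its condition \<open>miss\<close> comes from minors of \<open>G\<close>, and
  \<open>meet\<close> from minors of the complement.\<close>

lemma srg_if_not_compliant:
  assumes G: "pair_graph G" and card_V: "card (pverts G) = 13" and nc: "\<not> compliant 3 G"
  shows "srg_13_6_2_3 (pverts G) (\<lambda>x y. (x, y) \<in> parcs G)"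
proof -
  let ?V = "pverts G" and ?E = "\<lambda>x y. (x, y) \<in> parcs G"
  let ?N = "\<lambda>v. {x \<in> ?V. ?E v x}" and ?M = "\<lambda>v. {x \<in> ?V. x \<noteq> v \<and> \<not> ?E v x}"
  have fin: "finite ?V" and wf: "\<And>x y. ?E x y \<Longrightarrow> x \<in> ?V \<and> y \<in> ?V"
    and sym: "\<And>x y. ?E x y \<Longrightarrow> ?E y x" and irrefl: "\<And>x. \<not> ?E x x"
    using G by (auto simp: pair_graph_iff sym_def irrefl_def)
  have V': "pverts (complement_graph G) = ?V"
    and E': "\<And>x y. (x, y) \<in> parcs (complement_graph G) \<longleftrightarrow> x \<in> ?V \<and> y \<in> ?V \<and> x \<noteq> y \<and> \<not> ?E x y"
    by (simp_all add: complement_graph_def)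
  have nc1: "max_degree H < card ?V - 3" if "is_minor H G" for H
    using nc that by (auto simp: compliant_def not_le)
  have nc2: "max_degree H < card (pverts (complement_graph G)) - 3" if "is_minor H (complement_graph G)" for H
    using nc that by (auto simp: compliant_def not_le V')
  have sum12: "card (?N v) + card (?M v) = 12" if "v \<in> ?V" for v
  proof -
    have "card (?N v \<union> ?M v) = card (?N v) + card (?M v)"
      using fin by (intro card_Un_disjoint) auto
    moreover have "?N v \<union> ?M v = ?V - {v}" using irrefl by auto
    ultimately show ?thesis using card_V that by simp
  qed
  have miss: "\<exists>x\<in>?M v. \<not> ?E a x \<and> \<not> ?E b x" if "a \<in> ?N v" "b \<in> ?N v" for v a b
    using not_compliant_common_non_nbr[OF G nc1, of v a b] that by blast
  have meet: "\<exists>a\<in>?N v. ?E a x \<and> ?E a y" if "v \<in> ?V" "x \<in> ?M v" "y \<in> ?M v" for v x y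
  proof -
    \<comment> \<open>In the complement \<open>x\<close> and \<open>y\<close> are neighbours of
      \<open>v\<close>, and a common non-neighbour there is a common neighbour in
      \<open>G\<close>.\<close>
    have "\<exists>z\<in>?V - {v}. \<not> (v \<noteq> z \<and> \<not> ?E v z) \<and> \<not> (x \<noteq> z \<and> \<not> ?E x z) \<and> \<not> (y \<noteq> z \<and> \<not> ?E y z)"
      using not_compliant_common_non_nbr[OF pair_graph_complement[OF G] nc2, of v x y] that
      unfolding V' E' by blast
    with that sym show ?thesis by blast
  qed
  note balanced = intersecting_incidence_balanced[where R = ?E, OF _ _ sum12 miss meet]
  show ?thesis
  proof
    fix x y assume xy: "?E x y"
    then have x: "x \<in> ?V" "y \<in> ?N x" using wf by auto
    \<comment> \<open>Of the six neighbours of \<open>y\<close>, one is \<open>x\<close> and three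
      are non-neighbours of \<open>x\<close>, which leaves two common neighbours.\<close>
    have "card (?N x) = 6" "card (?N y) = 6" "card {z \<in> ?M x. ?E y z} = 3"
      using balanced(1)[of x] balanced(1)[of y] balanced(3)[of x y] x fin by simp_all
    moreover have "card ({z \<in> ?V. ?E x z \<and> ?E y z} \<union> {z \<in> ?M x. ?E y z}) =
        card {z \<in> ?V. ?E x z \<and> ?E y z} + card {z \<in> ?M x. ?E y z}"
      using fin by (intro card_Un_disjoint) auto
    moreover have "?N y - {x} = {z \<in> ?V. ?E x z \<and> ?E y z} \<union> {z \<in> ?M x. ?E y z}"
      using irrefl by auto
    moreover have "card (?N y - {x}) = card (?N y) - 1"
      using x(1) sym[OF xy] fin by simp
    ultimately show "card {z \<in> ?V. ?E x z \<and> ?E y z} = 2" by simp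
  next
    fix x y assume "x \<in> ?V" "y \<in> ?V" "x \<noteq> y" "\<not> ?E x y"
    then have "card {a \<in> ?N x. ?E a y} = 3"
      using balanced(2)[of x y] fin by simp
    have "a \<in> ?N x \<and> ?E a y \<longleftrightarrow> a \<in> ?V \<and> ?E x a \<and> ?E y a" for a
      using sym[of a y] sym[of y a] by blast
    then have "{a \<in> ?N x. ?E a y} = {z \<in> ?V. ?E x z \<and> ?E y z}"
      by (rule Collect_cong)
    with \<open>card {a \<in> ?N x. ?E a y} = 3\<close> show "card {z \<in> ?V. ?E x z \<and> ?E y z} = 3"
      by (simp only:)
  next
    fix x assume "x \<in> ?V"
    then show "card {y \<in> ?V. ?E x y} = 6" using balanced(1)[of x] fin by simp
  qed (use card_V sym irrefl wf in blast)+
qed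

theorem theorem6:
  shows "(pair_graph QR13 \<and> card (pverts QR13) = 13 \<and> \<not> compliant 3 QR13) \<and>
         (\<forall>G :: 'a pair_pre_digraph.
            pair_graph G \<and> card (pverts G) = 13 \<and> \<not> compliant 3 G \<longrightarrow> graph_iso G QR13)"
proof (intro conjI allI impI)
  show "card (pverts QR13) = 13" by (simp add: QR13_def)
next
  fix G :: "'a pair_pre_digraph"
  assume "pair_graph G \<and> card (pverts G) = 13 \<and> \<not> compliant 3 G"
  then have G: "pair_graph G" "card (pverts G) = 13" "\<not> compliant 3 G" by auto
  interpret srg_13_6_2_3 "pverts G" "\<lambda>x y. (x, y) \<in> parcs G"
    using srg_if_not_compliant[OF G] .
  obtain L where L: "bij_betw L {0..<13::int} (pverts G)"
    and arcs: "\<And>i j. i \<in> {0..<13} \<Longrightarrow> j \<in> {0..<13} \<Longrightarrow>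
      (L i, L j) \<in> parcs G \<longleftrightarrow> (i - j) mod 13 \<in> {1, 3, 4, 9, 10, 12}"
    using paley_labelling_exists unfolding paley_labelling_def by blast
  have QR: "pverts QR13 = {0..<13}" "parcs QR13 = {(x, y). x \<in> {0..<13} \<and> y \<in> {0..<13} \<and> (x - y) mod 13 \<in> {1, 3, 4, 9, 10, 12}}"
    unfolding QR13_eq_circulant circulant_13_def by (simp_all only: pair_pre_digraph.simps)
  \<comment> \<open>The labelling maps residues to vertices, so its inverse is the isomorphism onto
    \<open>QR13\<close>.\<close>
  define f where "f = the_inv_into {0..<13} L"
  have f: "bij_betw f (pverts G) {0..<13}"
    unfolding f_def by (rule bij_betw_the_inv_into[OF L])
  have Lf: "L (f x) = x" if "x \<in> pverts G" for x
    unfolding f_def by (rule f_the_inv_into_f_bij_betw[OF L that])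
  show "graph_iso G QR13"
  proof (rule graph_isoI[OF G(1) pair_graph_QR13, of f])
    show "bij_betw f (pverts G) (pverts QR13)" by (simp only: QR(1) f)
    fix x y assume x: "x \<in> pverts G" and y: "y \<in> pverts G"
    show "(x, y) \<in> parcs G \<longleftrightarrow> (f x, f y) \<in> parcs QR13"
      using arcs[OF bij_betw_apply[OF f x] bij_betw_apply[OF f y]] bij_betw_apply[OF f x] bij_betw_apply[OF f y]
      by (simp only: Lf[OF x] Lf[OF y] QR(2) mem_Collect_eq case_prod_conv simp_thms)
  qed
qed (use pair_graph_QR13 QR13_not_compliant in auto)

end
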